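(* For any positive integer $k\le 5$, there exist infinitely many non-Hamiltonian $1$-planar perfect graphs with connectivity $k$ (that is, graphs $G$ with $\kappa(G)=k$).
   Context: All graphs are finite and simple; graphs are counted up to isomorphism. A subset $S\subseteq V(G)$ is a separator of $G$ if $G-S$ is disconnected. The connectivity $\kappa(G)$ of a non-complete graph $G$ is the minimum size of a separator of $G$; if $G$ is complete, $\kappa(G)=|V(G)|-1$. A Hamiltonian cycle in $G$ is a cycle that visits every vertex of $G$ exactly once; $G$ is Hamiltonian if it contains a Hamiltonian cycle, and non-Hamiltonian otherwise. A graph is $1$-planar if it can be drawn in the plane such that each edge is crossed at most once. A graph $G$ is perfect if, for every induced subgraph $H$ of $G$, the clique number $\omega(H)$ equals the chromatic number $\chi(H)$. *)

theory Defs
  imports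
    "HOL-Analysis.Analysis"
    "HOL-Library.Ramsey"
    "Graph_Theory.Graph_Theory"
begin

text \<open>
  Undirected graphs are represented as symmetric digraphs, as in \<^theory>\<open>Graph_Theory.Digraph\<close>.
\<close>

definition edge_set :: "('a, 'b) pre_digraph \<Rightarrow> 'a set set" where
  "edge_set G = {{u, v} | u v. (u, v) \<in> arcs_ends G}"

text \<open>
  The null graph is \<^emph>\<open>not\<close> connected in the sense of \<^const>\<open>Digraph_Component.connected\<close>; the
  condition that some vertex remains keeps \<open>V(G)\<close> from being a separator.
\<close>

definition separator :: "('a, 'b) pre_digraph \<Rightarrow> 'a set \<Rightarrow> bool" where
  "separator G S \<longleftrightarrow>
     S \<subseteq> verts G \<and> verts G - S \<noteq> {} \<and>
     \<not> Digraph_Component.connected (induce_subgraph G (verts G - S))"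

definition connectivity :: "('a, 'b) pre_digraph \<Rightarrow> nat" where
  "connectivity G =
     (if complete_digraph (card (verts G)) G then card (verts G) - 1
      else Min (card ` {S. separator G S}))"

text \<open>
  \<^const>\<open>pre_digraph.cycle\<close> also admits the closed walk \<open>u, v, u\<close> along a single edge, which is not a
  cycle of an undirected graph; hence the bound on the length.
\<close>

definition hamiltonian :: "('a, 'b) pre_digraph \<Rightarrow> bool" where
  "hamiltonian G \<longleftrightarrow>
     (\<exists>p. pre_digraph.cycle G p \<and> 3 \<le> length p \<and> tail G ` set p = verts G)"

definition clique_number :: "('a, 'b) pre_digraph \<Rightarrow> nat" where
  "clique_number G = Max (card ` {W. W \<subseteq> verts G \<and> clique W (edge_set G)})"

definition colorable :: "('a, 'b) pre_digraph \<Rightarrow> nat \<Rightarrow> bool" where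
  "colorable G n \<longleftrightarrow>
     (\<exists>c :: 'a \<Rightarrow> nat. c ` verts G \<subseteq> {..<n} \<and> (\<forall>(u, v) \<in> arcs_ends G. c u \<noteq> c v))"

definition chromatic_number :: "('a, 'b) pre_digraph \<Rightarrow> nat" where
  "chromatic_number G = (LEAST n. colorable G n)"

definition perfect :: "('a, 'b) pre_digraph \<Rightarrow> bool" where
  "perfect G \<longleftrightarrow> (\<forall>H. induced_subgraph H G \<longrightarrow> clique_number H = chromatic_number H)"

text \<open>
  A drawing places the vertices at distinct points and draws every edge as a simple arc between its
  end vertices that passes through no other vertex.
\<close>

definition drawing ::
  "('a, 'b) pre_digraph \<Rightarrow> ('a \<Rightarrow> complex) \<Rightarrow> ('a set \<Rightarrow> real \<Rightarrow> complex) \<Rightarrow> bool" where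
  "drawing G pos \<gamma> \<longleftrightarrow>
     inj_on pos (verts G) \<and>
     (\<forall>e \<in> edge_set G.
        arc (\<gamma> e) \<and> {pathstart (\<gamma> e), pathfinish (\<gamma> e)} = pos ` e \<and>
        path_image (\<gamma> e) \<inter> pos ` verts G = pos ` e)"

text \<open>
  Every common interior point of two edges counts as a crossing, tangential contact and points
  shared by edges with a common end vertex included. Crossings are recorded together with the other
  edge, so that an edge through a common point of three edges is crossed twice there.
\<close>

definition crossings ::
  "('a, 'b) pre_digraph \<Rightarrow> ('a set \<Rightarrow> real \<Rightarrow> complex) \<Rightarrow> 'a set \<Rightarrow> ('a set \<times> complex) set" where
  "crossings G \<gamma> e =
     {(f, x). f \<in> edge_set G \<and> f \<noteq> e \<and> x \<in> \<gamma> e ` {0<..<1} \<and> x \<in> \<gamma> f ` {0<..<1}}"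

definition one_planar :: "('a, 'b) pre_digraph \<Rightarrow> bool" where
  "one_planar G \<longleftrightarrow>
     (\<exists>pos \<gamma>. drawing G pos \<gamma> \<and>
        (\<forall>e \<in> edge_set G. finite (crossings G \<gamma> e) \<and> card (crossings G \<gamma> e) \<le> 1))"

text \<open>
  Every finite simple graph is isomorphic to one on natural numbers, so the type \<^typ>\<open>nat\<close> of
  vertices loses nothing when graphs are counted up to isomorphism.
\<close>

definition iso_rel :: "(nat pair_pre_digraph \<times> nat pair_pre_digraph) set" where
  "iso_rel = {(G, H). digraph_iso (with_proj G) (with_proj H)}"

end

theory Submission
  imports Defs
begin

text \<open>
  The graphs are bipartite, hence perfect, and their colour classes have different sizes, so they
  are not Hamiltonian. The vertices lie in seven rows of a cylinder, of widths
  \<open>1, t, 2t, 2t, 2t, t, 1\<close>, with edges between consecutive rows only. Between two rows of width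
  \<open>2t\<close> every vertex is joined to the three nearest angles of the other row, between a row of width \<open>t\<close> and one of
  width \<open>2t\<close> every vertex of the short row is joined to four consecutive angles, and the two poles
  are joined to the whole adjacent row. With straight edges on the cylinder every edge is crossed
  at most once, because two edges cross only if their ends are in opposite order. The odd and even
  rows have \<open>4t\<close> and \<open>4t + 2\<close> vertices.

  A proper non-empty set of \<open>n\<close> vertices in a row of width \<open>2t\<close> has at least \<open>n + 2\<close> neighbours
  in an adjacent row of that width, unless these fill the row. Counting row by row, if at most four
  vertices are deleted then first the middle row and then both halves lie on one side, so the graph
  is 5-connected for \<open>t \<ge> 5\<close>. Deleting all but \<open>k\<close> edges at a vertex of degree \<open>5\<close> gives
  connectivity exactly \<open>k\<close>: a smaller separator, together with that vertex, would separate the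
  original graph.
\<close>

section \<open>Separations, bipartite graphs and isomorphism classes\<close>

text \<open>Exhibiting both sides replaces reachability by a non-adjacency condition. Arcs are
  excluded in both directions because \<open>G\<close> need not be symmetric and connectedness
  refers to the symmetric closure.\<close>

definition separation :: "'a pair_pre_digraph \<Rightarrow> 'a set \<Rightarrow> 'a set \<Rightarrow> 'a set \<Rightarrow> bool" where
  "separation G S C D \<longleftrightarrow>
     C \<union> D = pverts G - S \<and> C \<inter> D = {} \<and> C \<noteq> {} \<and> D \<noteq> {} \<and>
     (\<forall>u\<in>C. \<forall>v\<in>D. (u, v) \<notin> parcs G \<and> (v, u) \<notin> parcs G)"

lemma separation_commute: "separation G S C D \<Longrightarrow> separation G S D C"
  unfolding separation_def by blast

lemma arcs_ends_induce_with_proj: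
  "arcs_ends (induce_subgraph (with_proj G) W) = {(u, v). (u, v) \<in> parcs G \<and> u \<in> W \<and> v \<in> W}"
  by (force simp: arcs_ends_def arc_to_ends_def)

text \<open>If \<open>v\<close> is unreachable from \<open>u\<close> in the remaining graph, the
  vertices reachable from \<open>u\<close> and all the others form the two sides. Conversely a walk
  starting in \<open>C\<close> can never leave \<open>C\<close>.\<close>

lemma separator_iff_separation:
  "separator (with_proj G) S \<longleftrightarrow> S \<subseteq> pverts G \<and> (\<exists>C D. separation G S C D)"
proof -
  define W where "W = pverts G - S"
  define R where "R = rtrancl_on W (({(u, v). (u, v) \<in> parcs G \<and> u \<in> W \<and> v \<in> W})\<^sup>s)"
  have conn: "Digraph_Component.connected (induce_subgraph (with_proj G) W) \<longleftrightarrow>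
      W \<noteq> {} \<and> (\<forall>u\<in>W. \<forall>v\<in>W. (u, v) \<in> R)"
    by (simp add: connected_conv arcs_ends_induce_with_proj R_def)
  have "(\<exists>u\<in>W. \<exists>v\<in>W. (u, v) \<notin> R) \<longleftrightarrow> (\<exists>C D. separation G S C D)"
  proof
    assume "\<exists>u\<in>W. \<exists>v\<in>W. (u, v) \<notin> R"
    then obtain u v where uv: "u \<in> W" "v \<in> W" "(u, v) \<notin> R" by blast
    have step: "(u, y) \<in> R" if "(u, x) \<in> R" "x \<in> W" "y \<in> W" "(x, y) \<in> parcs G \<or> (y, x) \<in> parcs G"
      for x y
      using that unfolding R_def by (auto simp: symcl_def intro: rtrancl_on_into_rtrancl_on)
    have "(u, u) \<in> R" using uv(1) unfolding R_def by (rule rtrancl_on_refl)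
    then have "separation G S {x\<in>W. (u, x) \<in> R} {x\<in>W. (u, x) \<notin> R}"
      using uv step unfolding separation_def W_def by blast
    then show "\<exists>C D. separation G S C D" by blast
  next
    assume "\<exists>C D. separation G S C D"
    then obtain C D where s: "separation G S C D" by blast
    then obtain u v where uv: "u \<in> C" "v \<in> D" unfolding separation_def by blast
    have "x \<in> C" if "(u, x) \<in> R" for x
      using that unfolding R_def
    proof (induction rule: rtrancl_on_induct)
      case base then show ?case using uv by simp
    next
      case (step x y)
      then show ?case using s unfolding separation_def W_def by (auto simp: symcl_def)
    qed
    then have "(u, v) \<notin> R" using uv s unfolding separation_def by blast
    moreover have "u \<in> W" "v \<in> W" using uv s unfolding separation_def W_def by blast+
    ultimately show "\<exists>u\<in>W. \<exists>v\<in>W. (u, v) \<notin> R" by blast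
  qed
  moreover have "W \<noteq> {}" if "separation G S C D" for C D
    using that unfolding separation_def W_def by blast
  ultimately have "(\<exists>C D. separation G S C D) \<longleftrightarrow>
      W \<noteq> {} \<and> \<not> Digraph_Component.connected (induce_subgraph (with_proj G) W)"
    using conn by metis
  then show ?thesis unfolding separator_def W_def by simp
qed

text \<open>The separation yields two non-adjacent vertices, so the graph is not complete and
  \<open>connectivity\<close> is given by its \<open>Min\<close> branch.\<close>

lemma connectivity_eqI:
  assumes fin: "finite (pverts G)"
    and S: "S \<subseteq> pverts G" "card S = k" "separation G S C D"
    and least: "\<And>Z C D. Z \<subseteq> pverts G \<Longrightarrow> card Z < k \<Longrightarrow> \<not> separation G Z C D"
  shows "connectivity (with_proj G) = k"
proof -
  obtain u v where "u \<in> C" "v \<in> D" using S(3) unfolding separation_def by blast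
  then have uv: "u \<in> pverts G" "v \<in> pverts G" "u \<noteq> v" "(u, v) \<notin> parcs G"
    using S(3) unfolding separation_def by blast+
  then have nc: "\<not> complete_digraph n (with_proj G)" for n
    unfolding complete_digraph_pair_def by blast
  have "finite {S. separator (with_proj G) S}"
    using fin by (rule finite_subset[rotated, OF finite_Pow_iff[THEN iffD2]])
      (auto simp: separator_def)
  moreover have "separator (with_proj G) S" using S by (auto simp: separator_iff_separation)
  moreover have "k \<le> card Z" if "separator (with_proj G) Z" for Z
    using that least[of Z] by (fastforce simp: separator_iff_separation not_less[symmetric])
  ultimately have "Min (card ` {S. separator (with_proj G) S}) = k"
    using S(2) by (intro Min_eqI) auto
  then show ?thesis using nc by (simp add: connectivity_def)
qed

text \<open>Send each vertex of \<open>B\<close> to its successor on the cycle. Successors are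
  distinct and lie outside the independent set \<open>B\<close>, so \<open>B\<close> cannot be
  larger than its complement.\<close>

lemma bipartite_not_hamiltonian:
  fixes G :: "'a pair_pre_digraph"
  assumes pg: "pair_graph G" and B: "B \<subseteq> pverts G" "card (pverts G - B) < card B"
    and indep: "\<And>u v. (u, v) \<in> parcs G \<Longrightarrow> u \<in> B \<Longrightarrow> v \<notin> B"
  shows "\<not> hamiltonian (with_proj G)"
proof
  interpret pair_graph G by (rule pg)
  assume "hamiltonian (with_proj G)"
  then obtain p u where p: "pre_digraph.awalk (with_proj G) u p u"
      "distinct (tl (pre_digraph.awalk_verts (with_proj G) u p))" "p \<noteq> []"
      and V: "fst ` set p = pverts G"
    unfolding hamiltonian_def pre_digraph.cycle_def by auto
  have sub: "set p \<subseteq> parcs G" using p(1) unfolding pre_digraph.awalk_def by simp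
  \<comment> \<open>Behind its first entry the vertex list consists of the arc heads, so
    distinctness on a cycle makes \<open>snd\<close> injective on the arcs.\<close>
  have pw: "pawalk_verts u p = fst (hd p) # map snd p"
    using awalk_verts_conv'[of u p u] p by (simp add: awalk_def)
  have "distinct (map snd p)" using p(2) pw by (simp add: awalk_verts_with_proj_eq)
  then have inj: "inj_on snd (set p)" by (simp add: distinct_map)
  define P where "P = {e \<in> set p. fst e \<in> B}"
  have "B = fst ` P" using V B unfolding P_def by auto
  moreover have "finite P" by (simp add: P_def)
  ultimately have "card B \<le> card P" by (metis card_image_le)
  also have "\<dots> = card (snd ` P)"
    using inj by (intro card_image[symmetric]) (auto simp: P_def inj_on_def)
  also have "\<dots> \<le> card (pverts G - B)"
  proof (rule card_mono)
    show "finite (pverts G - B)" using pair_finite_verts by simp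
    show "snd ` P \<subseteq> pverts G - B"
      using sub indep arc_snd_in_verts unfolding P_def by force
  qed
  finally show False using B(2) by simp
qed

text \<open>Subgraphs inherit the bipartition. Both numbers are 0 without vertices, 1 with vertices
  but no arcs, and 2 as soon as there is an arc; the three cases of the proof are these.\<close>

lemma bipartite_perfect:
  fixes G :: "'a pair_pre_digraph"
  assumes pg: "pair_graph G"
    and indep: "\<And>u v. (u, v) \<in> parcs G \<Longrightarrow> u \<in> B \<longleftrightarrow> v \<notin> B"
  shows "perfect (with_proj G)"
  unfolding perfect_def
proof (intro allI impI)
  interpret pair_graph G by (rule pg)
  fix H assume "induced_subgraph H (with_proj G)"
  then have sub: "subgraph H (with_proj G)" unfolding induced_subgraph_def by simp
  then have HG: "verts H \<subseteq> pverts G" "arcs H \<subseteq> parcs G" "tail H = fst" "head H = snd" "wf_digraph H"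
    unfolding subgraph_def compatible_def by auto
  interpret H: wf_digraph H by (rule HG)
  have ends: "arcs_ends H = arcs H"
    using HG by (auto simp: arcs_ends_def arc_to_ends_def)
  have fin: "finite (verts H)" using HG pair_finite_verts finite_subset by blast
  let ?K = "{W. W \<subseteq> verts H \<and> clique W (edge_set H)}"
  have finK: "finite ?K" using fin by simp
  have edge: "u \<in> verts H" "v \<in> verts H" "u \<in> B \<longleftrightarrow> v \<notin> B" if "(u, v) \<in> arcs H" for u v
    using H.wellformed[OF that] HG that indep by auto
  have adj: "(u, v) \<in> arcs H \<or> (v, u) \<in> arcs H" if "{u, v} \<in> edge_set H" for u v
    using that ends by (auto simp: edge_set_def doubleton_eq_iff)
  have cl: "clique_number H = n"
    if "\<And>W. W \<in> ?K \<Longrightarrow> card W \<le> n" "W0 \<in> ?K" "card W0 = n" for n W0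
    unfolding clique_number_def using that finK by (intro Max_eqI) auto
  consider "verts H = {}" | "verts H \<noteq> {}" "arcs H = {}" | "arcs H \<noteq> {}" by blast
  then show "clique_number H = chromatic_number H"
  proof cases
    case 1
    then have "arcs H = {}" using edge(1) by fastforce
    then have "colorable H 0" using 1 ends by (auto simp: colorable_def)
    then have "chromatic_number H = 0" by (simp add: chromatic_number_def)
    moreover have "clique_number H = 0" using 1 by (intro cl[of _ "{}"]) (auto simp: clique_def)
    ultimately show ?thesis by simp
  next
    case 2
    then obtain x where x: "x \<in> verts H" by blast
    have "colorable H 1" using 2 ends by (auto simp: colorable_def intro!: exI[of _ "\<lambda>_. 0"])
    moreover have "\<not> colorable H n" if "n < 1" for n using that x by (auto simp: colorable_def)
    ultimately have "chromatic_number H = 1" unfolding chromatic_number_def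
      by (metis Least_equality not_less)
    moreover have "clique_number H = 1"
    proof (rule cl[of _ "{x}"])
      fix W assume W: "W \<in> ?K"
      have "u = v" if "u \<in> W" "v \<in> W" for u v
        using W that adj[of u v] 2 by (auto simp: clique_def)
      then show "card W \<le> 1" using fin W by (intro card_le_Suc0_iff_eq[THEN iffD2, folded One_nat_def])
          (auto intro: finite_subset)
    qed (use x in \<open>auto simp: clique_def\<close>)
    ultimately show ?thesis by simp
  next
    case 3
    then obtain x y where xy: "(x, y) \<in> arcs H" by auto
    then have ne: "x \<noteq> y" using edge(3) by blast
    have "colorable H 2" unfolding colorable_def ends
      using edge(3) by (intro exI[of _ "\<lambda>v. if v \<in> B then 0 else 1"]) (auto split: if_splits)
    moreover have "2 \<le> n" if n: "colorable H n" for n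
    proof -
      obtain c :: "'a \<Rightarrow> nat" where c: "c ` verts H \<subseteq> {..<n}" "\<forall>(u, v)\<in>arcs_ends H. c u \<noteq> c v"
        using n unfolding colorable_def by blast
      have "c x < n" "c y < n" "c x \<noteq> c y" using c xy edge(1,2)[OF xy] ends by auto
      then show ?thesis by linarith
    qed
    ultimately have "chromatic_number H = 2" unfolding chromatic_number_def
      by (intro Least_equality) auto
    moreover have "clique_number H = 2"
    proof (rule cl[of _ "{x, y}"])
      fix W assume W: "W \<in> ?K"
      \<comment> \<open>Vertices on the same side are never adjacent, so a clique has at most one
        vertex on each side.\<close>
      have side: "u = v" if "u \<in> W" "v \<in> W" "u \<in> B \<longleftrightarrow> v \<in> B" for u v
        using W that adj[of u v] edge(3)[of u v] edge(3)[of v u] by (auto simp: clique_def)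
      have finW: "finite W" using fin W by (auto intro: finite_subset)
      have "card (W \<inter> B) \<le> Suc 0" "card (W - B) \<le> Suc 0"
        using side finW by (auto simp: card_le_Suc0_iff_eq)
      then show "card W \<le> 2" using card_Int_Diff[OF finW, of B] by simp
    qed (use xy ne edge(1,2)[OF xy] ends in \<open>auto simp: clique_def edge_set_def\<close>)
    ultimately show ?thesis by simp
  qed
qed

section \<open>Isomorphism classes and the number of vertices\<close>

lemma iso_rel_refl:
  assumes "pair_graph G" shows "(G, G) \<in> iso_rel"
proof -
  interpret pair_graph G by (rule assms)
  let ?f = "\<lparr>iso_verts = id, iso_arcs = id, iso_head = snd, iso_tail = fst\<rparr>"
  have "pre_digraph.digraph_isomorphism (with_proj G) ?f"
    unfolding pre_digraph.digraph_isomorphism_def using wf_digraph by simp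
  moreover have "with_proj G = app_iso ?f (with_proj G)"
    by (simp add: app_iso_def with_proj_def)
  ultimately show ?thesis unfolding iso_rel_def digraph_iso_def by blast
qed

lemma iso_rel_card_pverts:
  assumes "(G, H) \<in> iso_rel" shows "card (pverts G) = card (pverts H)"
proof -
  obtain f where f: "pre_digraph.digraph_isomorphism (with_proj G) f" "with_proj H = app_iso f (with_proj G)"
    using assms unfolding iso_rel_def digraph_iso_def by auto
  have "pverts H = iso_verts f ` pverts G" using arg_cong[OF f(2), of verts] by simp
  moreover have "inj_on (iso_verts f) (pverts G)"
    using f(1) by (simp add: pre_digraph.digraph_isomorphism_def)
  ultimately show ?thesis by (simp add: card_image)
qed

text \<open>Reflexivity puts \<open>f b\<close> into its own class. If that is also the class of
  \<open>f a\<close>, then \<open>f a\<close> and \<open>f b\<close> have equally many vertices, so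
  \<open>a = b\<close>.\<close>

lemma infinite_iso_classes:
  fixes f :: "nat \<Rightarrow> nat pair_pre_digraph"
  assumes "\<And>n. f n \<in> A" "\<And>n. pair_graph (f n)" "inj (\<lambda>n. card (pverts (f n)))"
  shows "infinite (A // iso_rel)"
proof -
  have "inj (\<lambda>n. iso_rel `` {f n})"
  proof (rule injI)
    fix a b assume "iso_rel `` {f a} = iso_rel `` {f b}"
    then have "(f a, f b) \<in> iso_rel" using iso_rel_refl[OF assms(2)[of b]] by blast
    then show "a = b" using iso_rel_card_pverts assms(3) by (auto dest: injD)
  qed
  then have "infinite (range (\<lambda>n. iso_rel `` {f n}))" by (rule range_inj_infinite)
  moreover have "range (\<lambda>n. iso_rel `` {f n}) \<subseteq> A // iso_rel"
    using assms(1) by (auto simp: quotient_def)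
  ultimately show ?thesis using finite_subset by blast
qed

section \<open>The lantern graphs\<close>

lemma card_cyclic_interval:
  fixes a l h m :: int
  assumes "h - l < m"
  shows "card ((\<lambda>d. (a + d) mod m) ` {l..h}) = nat (h - l + 1)"
proof -
  have "inj_on (\<lambda>d. (a + d) mod m) {l..h}"
  proof (rule inj_onI)
    fix x y assume xy: "x \<in> {l..h}" "y \<in> {l..h}" "(a + x) mod m = (a + y) mod m"
    then have "m dvd (a + x) - (a + y)" using mod_eq_dvd_iff by blast
    then have "m dvd x - y" by simp
    moreover have "\<bar>x - y\<bar> < m" using xy assms by auto
    ultimately show "x = y" using dvd_imp_le_int[of "x - y" m] by force
  qed
  then show ?thesis by (simp add: card_image)
qed

lemma cyclic_closed_full:
  fixes m s :: int and A :: "int set"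
  assumes m: "0 < m" and s: "s = 1 \<or> s = -1" and A: "A \<subseteq> {0..<m}" "A \<noteq> {}"
    and closed: "\<And>a. a \<in> A \<Longrightarrow> (a + s) mod m \<in> A"
  shows "A = {0..<m}"
proof -
  obtain a where a: "a \<in> A" using A by blast
  have iter: "(a + int n * s) mod m \<in> A" for n
  proof (induction n)
    case 0
    then show ?case using a A by auto
  next
    case (Suc n)
    then have "((a + int n * s) mod m + s) mod m \<in> A" by (rule closed)
    then have "(a + int n * s + s) mod m \<in> A" by (simp only: mod_add_left_eq)
    then show ?case by (simp add: algebra_simps)
  qed
  have "x \<in> A" if "x \<in> {0..<m}" for x
  proof -
    have "\<exists>n. (a + int n * s) mod m = x"
    proof -
      \<comment> \<open>The number of steps of size \<open>s\<close> from \<open>a\<close> to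
        \<open>x\<close>, reduced modulo \<open>m\<close>; it works because
        \<open>s * s = 1\<close>.\<close>
      define n where "n = nat (((x - a) * s) mod m)"
      have n: "int n = ((x - a) * s) mod m" using m by (simp add: n_def)
      have "(a + int n * s) mod m = (a + (x - a) * s * s) mod m"
        unfolding n by (metis mod_add_right_eq mod_mult_left_eq)
      also have "(a + (x - a) * s * s) = x" using s by auto
      finally show ?thesis using that by auto
    qed
    then show ?thesis using iter by metis
  qed
  then show ?thesis using A by blast
qed

text \<open>Enlarge \<open>A\<close> by the shift by 1 to \<open>A'\<close>, then \<open>A'\<close>
  by the shift by -1 to \<open>A''\<close>. Either enlargement is strict, as a non-empty set closed
  under a unit shift is the whole row, whereas everything stays inside the proper subset
  \<open>B\<close>. Shifting back the points \<open>a + 1\<close> only returns to \<open>A\<close>,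
  so \<open>A''\<close> does stay in \<open>B\<close>.\<close>

lemma cyclic_expansion:
  fixes m :: int and A B :: "int set"
  assumes m: "0 < m" and A: "A \<subseteq> {0..<m}" "A \<noteq> {}" and B: "B \<subset> {0..<m}"
    and AB: "\<And>a d. a \<in> A \<Longrightarrow> -1 \<le> d \<Longrightarrow> d \<le> 1 \<Longrightarrow> (a + d) mod m \<in> B"
  shows "card A + 2 \<le> card B"
proof -
  define A' where "A' = A \<union> (\<lambda>a. (a + 1) mod m) ` A"
  define A'' where "A'' = A' \<union> (\<lambda>a. (a - 1) mod m) ` A'"
  have mods: "a mod m = a" if "a \<in> A" for a using A that by auto
  have sub: "A'' \<subseteq> B"
  proof -
    have "A \<subseteq> B" using AB[of _ 0] mods by force
    moreover have "((a + 1) mod m - 1) mod m \<in> B" if "a \<in> A" for a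
      using mods[OF that] AB[OF that, of 0] by (simp add: mod_diff_left_eq)
    ultimately show ?thesis using AB[of _ 1] AB[of _ "-1"] unfolding A''_def A'_def by auto
  qed
  have finB: "finite B" using B finite_subset by blast
  have sub': "A \<subseteq> A'" "A' \<subseteq> A''" unfolding A'_def A''_def by auto
  have "A \<noteq> A'"
  proof
    assume "A = A'"
    then have "A = {0..<m}" using m A by (intro cyclic_closed_full[where s = 1]) (auto simp: A'_def)
    then show False using sub sub' B by blast
  qed
  moreover have "A' \<noteq> A''"
  proof
    assume "A' = A''"
    then have "A' = {0..<m}" using m A sub sub' B
      by (intro cyclic_closed_full[where s = "-1"]) (auto simp: A''_def)
    then show False using sub sub' B by blast
  qed
  moreover have "finite A''" using finite_subset[OF sub finB] .
  moreover from this have "finite A'" using finite_subset[OF sub'(2)] by blast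
  ultimately have "card A < card A'" "card A' < card A''"
    using sub' by (auto intro!: psubset_card_mono)
  moreover have "card A'' \<le> card B" using sub finB by (rule card_mono[rotated])
  ultimately show ?thesis by simp
qed

text \<open>
  Angles are integers modulo \<open>m = 2t\<close>; the rows of width \<open>t\<close> occupy the even angles only, and
  the two poles sit at angle \<open>0\<close>. The edges from row \<open>i\<close> to row \<open>Suc i\<close> are described on the
  universal cover of the cylinder: \<open>lift m i a b\<close> is an edge between the angles \<open>a\<close> and \<open>b\<close> there.
\<close>

definition node :: "int \<Rightarrow> nat \<Rightarrow> int \<Rightarrow> nat" where
  "node m i a = prod_encode (i, nat (a mod m))"

lemma node_eq_iff:
  assumes "0 < m" shows "node m i a = node m j b \<longleftrightarrow> i = j \<and> a mod m = b mod m"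
  using assms by (auto simp: node_def prod_encode_eq eq_nat_nat_iff)

lemma node_mod [simp]: "node m i (a mod m) = node m i a"
  by (simp add: node_def)

definition site :: "int \<Rightarrow> nat \<Rightarrow> int \<Rightarrow> bool" where
  "site m i a \<longleftrightarrow> i \<le> 6 \<and> (i = 0 \<or> i = 6 \<longrightarrow> m dvd a) \<and> (i = 1 \<or> i = 5 \<longrightarrow> even a)"

definition lift :: "int \<Rightarrow> nat \<Rightarrow> int \<Rightarrow> int \<Rightarrow> bool" where
  "lift m i a b \<longleftrightarrow>
     i = 0 \<and> m dvd a \<and> even b \<and> a \<le> b \<and> b < a + m \<or>
     i = 1 \<and> even a \<and> - 1 \<le> b - a \<and> b - a \<le> 2 \<or>
     (i = 2 \<or> i = 3) \<and> - 1 \<le> b - a \<and> b - a \<le> 1 \<or>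
     i = 4 \<and> even b \<and> - 1 \<le> a - b \<and> a - b \<le> 2 \<or>
     i = 5 \<and> m dvd b \<and> even a \<and> b \<le> a \<and> a < b + m"

text \<open>Reflection exchanges row \<open>i\<close> and row \<open>6 - i\<close>; it carries the
  counts for the upper half over to the lower half.\<close>

lemma lift_mirror:
  assumes "i \<le> 5" shows "lift m i a b \<longleftrightarrow> lift m (5 - i) b a"
proof -
  have "i = 0 \<or> i = 1 \<or> i = 2 \<or> i = 3 \<or> i = 4 \<or> i = 5" using assms by linarith
  then show ?thesis by (elim disjE) (auto simp: lift_def)
qed

lemma lift_site:
  assumes "even m" "lift m i a b" shows "site m i a" "site m (Suc i) b"
  using assms dvd_trans[of 2 m] unfolding lift_def site_def by auto

definition lantern_verts :: "int \<Rightarrow> nat set" where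
  "lantern_verts m = {node m i a |i a. site m i a}"

definition lantern_adj :: "int \<Rightarrow> nat \<Rightarrow> nat \<Rightarrow> bool" where
  "lantern_adj m u v \<longleftrightarrow>
     (\<exists>i a b. lift m i a b \<and> {u, v} = {node m i a, node m (Suc i) b})"

definition occupied :: "int \<Rightarrow> nat set \<Rightarrow> nat \<Rightarrow> int set" where
  "occupied m S i = {a \<in> {0..<m}. node m i a \<in> S}"

lemma finite_occupied [simp]: "finite (occupied m S i)"
  unfolding occupied_def by (rule finite_subset[of _ "{0..<m}"]) auto

lemma mod_mem_occupied_iff:
  "0 < m \<Longrightarrow> a mod m \<in> occupied m S i \<longleftrightarrow> node m i a \<in> S"
  by (simp add: occupied_def)

lemma sum_card_occupied_le:
  assumes "0 < m" "finite S" shows "(\<Sum>i\<le>n. card (occupied m S i)) \<le> card S"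
proof -
  have "(\<Sum>i\<le>n. card (occupied m S i)) = (\<Sum>i\<le>n. card (node m i ` occupied m S i))"
    using assms(1) by (intro sum.cong refl card_image[symmetric])
      (auto simp: inj_on_def node_eq_iff occupied_def)
  also have "\<dots> = card (\<Union>i\<le>n. node m i ` occupied m S i)"
    using assms(1) by (intro card_UN_disjoint[symmetric]) (auto simp: node_eq_iff)
  also have "\<dots> \<le> card S"
    using assms(2) by (intro card_mono) (auto simp: occupied_def)
  finally show ?thesis .
qed

text \<open>
  \<open>c\<close>, \<open>d\<close>, \<open>z\<close> count, row by row, the vertices on the two sides of a separation and in the
  separator. The conditions concern the upper half only; the lower half is its mirror image.
\<close>

definition expands :: "(nat \<Rightarrow> nat) \<Rightarrow> (nat \<Rightarrow> nat) \<Rightarrow> (nat \<Rightarrow> nat) \<Rightarrow> bool" where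
  "expands c d z \<longleftrightarrow>
     (1 \<le> c 0 \<longrightarrow> d 1 = 0) \<and> (1 \<le> c 1 \<longrightarrow> d 0 = 0) \<and>
     (1 \<le> c 1 \<longrightarrow> 4 \<le> c 2 + z 2) \<and> (1 \<le> c 2 \<longrightarrow> 2 \<le> c 1 + z 1) \<and>
     (1 \<le> c 2 \<longrightarrow> 3 \<le> c 3 + z 3) \<and> (1 \<le> c 3 \<longrightarrow> 3 \<le> c 2 + z 2) \<and>
     (1 \<le> c 2 \<and> 1 \<le> d 3 \<longrightarrow> c 2 + 2 \<le> c 3 + z 3) \<and>
     (1 \<le> c 3 \<and> 1 \<le> d 2 \<longrightarrow> c 3 + 2 \<le> c 2 + z 2)"

lemma expandsD:
  assumes "expands c d z"
  shows "1 \<le> c 0 \<Longrightarrow> d 1 = 0" "1 \<le> c 1 \<Longrightarrow> d 0 = 0"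
    "1 \<le> c 1 \<Longrightarrow> 4 \<le> c 2 + z 2" "1 \<le> c 2 \<Longrightarrow> 2 \<le> c 1 + z 1"
    "1 \<le> c 2 \<Longrightarrow> 3 \<le> c 3 + z 3" "1 \<le> c 3 \<Longrightarrow> 3 \<le> c 2 + z 2"
    "1 \<le> c 2 \<Longrightarrow> 1 \<le> d 3 \<Longrightarrow> c 2 + 2 \<le> c 3 + z 3"
    "1 \<le> c 3 \<Longrightarrow> 1 \<le> d 2 \<Longrightarrow> c 3 + 2 \<le> c 2 + z 2"
  using assms unfolding expands_def by simp_all

text \<open>Neighbours of \<open>P\<close> lie in \<open>P\<close> or \<open>R\<close>. The bounds 4
  and 3 count the consecutive angles adjacent to one vertex, the bound 2 its two neighbours at even
  angles. The gain \<open>+ 2\<close> is \<open>cyclic_expansion\<close>, which applies since a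
  non-empty \<open>Q j\<close> keeps \<open>P j \<union> R j\<close> from filling the row.\<close>

lemma expands_occupied:
  fixes m :: int and P Q R :: "nat \<Rightarrow> int set"
  assumes m: "even m" "10 \<le> m"
    and sub: "\<And>i. P i \<subseteq> {0..<m}" "\<And>i. Q i \<subseteq> {0..<m}" "\<And>i. R i \<subseteq> {0..<m}"
    and disj: "\<And>i. P i \<inter> Q i = {}" "\<And>i. R i \<inter> Q i = {}"
    and sites: "\<And>i a. i \<le> 1 \<Longrightarrow> a \<in> P i \<Longrightarrow> site m i a" "\<And>i a. i \<le> 1 \<Longrightarrow> a \<in> Q i \<Longrightarrow> site m i a"
    and up: "\<And>i a b. i \<le> 2 \<Longrightarrow> a \<in> P i \<Longrightarrow> lift m i a b \<Longrightarrow> b mod m \<in> P (Suc i) \<union> R (Suc i)"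
    and down: "\<And>i a b. i \<le> 2 \<Longrightarrow> b \<in> P (Suc i) \<Longrightarrow> lift m i a b \<Longrightarrow> a mod m \<in> P i \<union> R i"
  shows "expands (card \<circ> P) (card \<circ> Q) (card \<circ> R)"
proof -
  have fin: "finite (P i)" "finite (Q i)" "finite (R i)" for i
    using sub finite_subset[of _ "{0..<m}"] by auto
  have pos: "1 \<le> card (P i) \<longleftrightarrow> P i \<noteq> {}" "1 \<le> card (Q i) \<longleftrightarrow> Q i \<noteq> {}" for i
    using fin[of i] by (auto simp: Suc_le_eq card_gt_0_iff)
  have psub: "P i \<union> R i \<subset> {0..<m}" if "Q i \<noteq> {}" for i
    using sub disj that by blast
  have interval: "nat (h - l + 1) \<le> card (P i) + card (R i)"
    if "\<And>d. l \<le> d \<Longrightarrow> d \<le> h \<Longrightarrow> (a + d) mod m \<in> P i \<union> R i" "h - l < m" for l h a i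
  proof -
    have "(\<lambda>d. (a + d) mod m) ` {l..h} \<subseteq> P i \<union> R i" using that(1) by fastforce
    then have "nat (h - l + 1) \<le> card (P i \<union> R i)"
      unfolding card_cyclic_interval[OF that(2), of a, symmetric] using fin
      by (intro card_mono) auto
    also have "\<dots> \<le> card (P i) + card (R i)" by (rule card_Un_le)
    finally show ?thesis .
  qed
  have expansion: "card (P i) + 2 \<le> card (P j) + card (R j)"
    if "P i \<noteq> {}" "Q j \<noteq> {}"
      "\<And>a d. a \<in> P i \<Longrightarrow> -1 \<le> d \<Longrightarrow> d \<le> 1 \<Longrightarrow> (a + d) mod m \<in> P j \<union> R j" for i j
    using cyclic_expansion[OF _ sub(1) that(1) psub[OF that(2)] that(3)] card_Un_le[of "P j" "R j"] m
    by fastforce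
  have ring: "(a + d) mod m \<in> P 3 \<union> R 3" if "a \<in> P 2" "-1 \<le> d" "d \<le> 1" for a d
    using up[of 2 a "a + d"] that by (simp add: lift_def)
  have ring': "(a + d) mod m \<in> P 2 \<union> R 2" if "a \<in> P 3" "-1 \<le> d" "d \<le> 1" for a d
    using down[of 2 a "a + d"] that by (simp add: lift_def)
  have zero: "a = 0" if "a \<in> P 0 \<or> a \<in> Q 0" for a
    using that sites[of 0 a] sub[of 0] zdvd_imp_le[of m a] by (force simp: site_def)
  have "Q 1 = {}" if "P 0 \<noteq> {}"
  proof -
    have "0 \<in> P 0" using that zero by blast
    \<comment> \<open>The pole at angle 0 is joined to every even angle in \<open>{0..<m}\<close>,
      hence to all of row 1.\<close>
    have "b \<in> P 1 \<union> R 1" if "b \<in> Q 1" for b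
      using up[OF _ \<open>0 \<in> P 0\<close>, of b] that sites(2)[OF _ that] sub(2)[of 1] m
      by (auto simp: lift_def site_def)
    then show ?thesis using disj by blast
  qed
  moreover have "Q 0 = {}" if "P 1 \<noteq> {}"
  proof (rule ccontr)
    assume "Q 0 \<noteq> {}"
    then have "0 \<in> Q 0" using zero by blast
    obtain b where "b \<in> P 1" using \<open>P 1 \<noteq> {}\<close> by blast
    then have "0 mod m \<in> P 0 \<union> R 0"
      using sites(1)[of 1 b] sub(1)[of 1] by (intro down[of 0 b]) (auto simp: lift_def site_def)
    then show False using \<open>0 \<in> Q 0\<close> disj by auto
  qed
  moreover have "4 \<le> card (P 2) + card (R 2)" if "P 1 \<noteq> {}"
  proof -
    obtain a where a: "a \<in> P 1" using \<open>P 1 \<noteq> {}\<close> by blast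
    then have "(a + d) mod m \<in> P 2 \<union> R 2" if "-1 \<le> d" "d \<le> 2" for d
      using up[of 1 a "a + d"] that a sites(1)[of 1 a] by (simp add: lift_def site_def numeral_2_eq_2)
    then show ?thesis using interval[of "-1" 2 a 2] m by simp
  qed
  moreover have "2 \<le> card (P 1) + card (R 1)" if "P 2 \<noteq> {}"
  proof -
    obtain b where b: "b \<in> P 2" using \<open>P 2 \<noteq> {}\<close> by blast
    \<comment> \<open>The even angles \<open>a\<close> with \<open>- 1 \<le> b - a\<close> and
      \<open>b - a \<le> 2\<close> are two consecutive even numbers; this is the smaller
      one.\<close>
    define a where "a = (if even b then b - 2 else b - 1)"
    have nb: "a mod m \<in> P 1 \<union> R 1" "(a + 2) mod m \<in> P 1 \<union> R 1"
      using down[of 1 b a] down[of 1 b "a + 2"] b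
      by (simp_all add: lift_def a_def numeral_2_eq_2 split: if_splits)
    have "a mod m \<noteq> (a + 2) mod m"
    proof
      assume "a mod m = (a + 2) mod m"
      then have "m dvd a - (a + 2)" using mod_eq_dvd_iff by blast
      then have "m dvd 2" by simp
      then show False using m zdvd_imp_le by force
    qed
    then have "2 \<le> card {a mod m, (a + 2) mod m}" by simp
    also have "\<dots> \<le> card (P 1 \<union> R 1)" using nb fin by (intro card_mono) auto
    also have "\<dots> \<le> card (P 1) + card (R 1)" by (rule card_Un_le)
    finally show ?thesis .
  qed
  moreover have "3 \<le> card (P 3) + card (R 3)" if "P 2 \<noteq> {}"
    using that interval[of "-1" 1 _ 3] ring m by fastforce
  moreover have "3 \<le> card (P 2) + card (R 2)" if "P 3 \<noteq> {}"
    using that interval[of "-1" 1 _ 2] ring' m by fastforce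
  moreover have "card (P 2) + 2 \<le> card (P 3) + card (R 3)" if "P 2 \<noteq> {}" "Q 3 \<noteq> {}"
    using expansion[OF that ring] .
  moreover have "card (P 3) + 2 \<le> card (P 2) + card (R 2)" if "P 3 \<noteq> {}" "Q 2 \<noteq> {}"
    using expansion[OF that ring'] .
  ultimately show ?thesis
    unfolding expands_def o_def pos by simp
qed

text \<open>If both sides met row 3, all four deletions would lie in that row. Then both sides reach
  row 2, hence row 1, and each of them excludes the other from the pole, which nevertheless has not
  been deleted.\<close>

lemma expands_middle:
  fixes c d z :: "nat \<Rightarrow> nat"
  assumes u: "expands c d z" "expands d c z"
      "expands (\<lambda>i. c (6 - i)) (\<lambda>i. d (6 - i)) (\<lambda>i. z (6 - i))"
      "expands (\<lambda>i. d (6 - i)) (\<lambda>i. c (6 - i)) (\<lambda>i. z (6 - i))"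
    and pole: "c 0 + d 0 + z 0 = 1"
    and z: "z 0 + z 1 + z 2 + z 3 + z 4 + z 5 + z 6 \<le> 4"
  shows "c 3 = 0 \<or> d 3 = 0"
proof (rule ccontr)
  assume "\<not> ?thesis"
  then have c3: "1 \<le> c 3" "1 \<le> d 3" by auto
  have one: "3 \<le> c 2 + z 2" "3 \<le> d 2 + z 2" "3 \<le> c 4 + z 4" "3 \<le> d 4 + z 4"
    using c3 u[THEN expandsD(6)] by simp_all
  have two: "c 2 + 2 \<le> c 3 + z 3 \<and> c 3 + 2 \<le> c 2 + z 2" if "1 \<le> c 2" "1 \<le> d 2"
    using c3 expandsD(7,8)[OF u(1)] that by simp
  have four: "c 4 + 2 \<le> c 3 + z 3 \<and> c 3 + 2 \<le> c 4 + z 4" if "1 \<le> c 4" "1 \<le> d 4"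
    using c3 expandsD(7,8)[OF u(3)] that by simp
  \<comment> \<open>With \<open>z 2 \<le> 2\<close> both sides meet row 2, and adding the two
    inequalities of \<open>two\<close> cancels \<open>c 2\<close> and \<open>c 3\<close>. Since only
    four deletions are available, the two bounds together leave \<open>z 3 = 4\<close> as the only
    possibility.\<close>
  have "z 2 + z 3 \<ge> 4" if "z 2 \<le> 2" using one two that by linarith
  moreover have "z 3 + z 4 \<ge> 4" if "z 4 \<le> 2" using one four that by linarith
  ultimately have "z 3 = 4" "z 2 = 0" "z 4 = 0" "z 0 = 0" "z 1 = 0" using z by linarith+
  then have "1 \<le> c 2" "1 \<le> d 2" using one by linarith+
  then have "2 \<le> c 1 + z 1" "2 \<le> d 1 + z 1" using u[THEN expandsD(4)] by blast+
  then have "1 \<le> c 1" "1 \<le> d 1" using \<open>z 1 = 0\<close> by linarith+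
  then have "d 0 = 0" "c 0 = 0" using u[THEN expandsD(2)] by blast+
  then show False using pole \<open>z 0 = 0\<close> by simp
qed

text \<open>A side missing row 3 is excluded from row 2, then from row 1, and finally from the
  pole.\<close>

lemma expands_cap:
  fixes c d z :: "nat \<Rightarrow> nat"
  assumes u: "expands c d z" "expands d c z"
    and t: "5 \<le> t" "c 0 + d 0 + z 0 = 1" "c 1 + d 1 + z 1 = t" "c 2 + d 2 + z 2 = 2 * t"
      "c 3 + d 3 + z 3 = 2 * t"
    and z: "z 0 + z 1 + z 2 + z 3 \<le> 4" and d3: "d 3 = 0"
  shows "d 0 = 0 \<and> d 1 = 0 \<and> d 2 = 0"
proof -
  have c3: "1 \<le> c 3" using t z d3 by linarith
  then have c2: "3 \<le> c 2 + z 2" using expandsD(6)[OF u(1)] by blast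
  have "d 2 = 0"
  proof (rule ccontr)
    assume "d 2 \<noteq> 0"
    then have "1 \<le> d 2" by simp
    then have "d 2 + 2 \<le> d 3 + z 3" "2 \<le> d 1 + z 1"
      using c3 expandsD(4,7)[OF u(2)] by blast+
    then have "1 \<le> d 1" "1 \<le> c 2" using c2 d3 z \<open>1 \<le> d 2\<close> by linarith+
    then have "2 \<le> c 1 + z 1" "4 \<le> d 2 + z 2"
      using expandsD(4)[OF u(1)] expandsD(3)[OF u(2)] by blast+
    then have "1 \<le> c 1" using \<open>d 2 + 2 \<le> d 3 + z 3\<close> \<open>1 \<le> d 2\<close> d3 z by linarith
    then have "d 0 = 0" "c 0 = 0" using \<open>1 \<le> d 1\<close> u[THEN expandsD(2)] by blast+
    \<comment> \<open>With \<open>d 3 = 0\<close> the two inequalities add up to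
      \<open>6 \<le> z 2 + z 3\<close>, too many deletions.\<close>
    then show False
      using \<open>d 2 + 2 \<le> d 3 + z 3\<close> \<open>4 \<le> d 2 + z 2\<close> d3 z t by linarith
  qed
  moreover have "d 1 = 0"
  proof (rule ccontr)
    assume "d 1 \<noteq> 0"
    then have "1 \<le> d 1" by simp
    then have "4 \<le> d 2 + z 2" "c 0 = 0" using expandsD(2,3)[OF u(2)] by blast+
    \<comment> \<open>All deletions lie in row 2, so the pole survives and belongs to side
      \<open>d\<close>. This empties \<open>c 1\<close>, although a vertex of side \<open>c\<close>
      in row 2 needs two vertices in row 1 that are on its side or deleted.\<close>
    then have z0: "z 0 = 0" "z 1 = 0" "z 2 = 4" using z \<open>d 2 = 0\<close> by linarith+
    then have "1 \<le> d 0" using t \<open>c 0 = 0\<close> by linarith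
    then have "c 1 = 0" using expandsD(1)[OF u(2)] by blast
    moreover have "1 \<le> c 2" using t z0 \<open>d 2 = 0\<close> by linarith
    then have "2 \<le> c 1 + z 1" using expandsD(4)[OF u(1)] by blast
    ultimately show False using z0 by simp
  qed
  moreover have "d 0 = 0"
  proof (rule ccontr)
    assume "d 0 \<noteq> 0"
    then have "1 \<le> d 0" by simp
    then have "c 1 = 0" using expandsD(1)[OF u(2)] by blast
    \<comment> \<open>All of row 1 would have to be deleted, but its width \<open>t\<close> is at
      least 5.\<close>
    then show False using t z \<open>d 1 = 0\<close> by linarith
  qed
  ultimately show ?thesis by simp
qed

section \<open>Sizes of the rows, finiteness and adjacency\<close>

lemma node_in_lantern_verts_iff:
  assumes "0 < m" "even m" shows "node m i a \<in> lantern_verts m \<longleftrightarrow> site m i a"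
proof -
  \<comment> \<open>As \<open>m\<close> is even, the parity of an angle survives reduction modulo
    \<open>m\<close>.\<close>
  have "site m i (a mod m) \<longleftrightarrow> site m i a" for a
    using dvd_mod_iff[OF assms(2), of a] dvd_mod_iff[of m m a] by (simp only: site_def dvd_refl simp_thms)
  then have periodic: "site m i b \<Longrightarrow> a mod m = b mod m \<Longrightarrow> site m i a" for a b
    by metis
  have "node m i a \<in> lantern_verts m \<longleftrightarrow> (\<exists>b. site m i b \<and> a mod m = b mod m)"
    unfolding lantern_verts_def by (simp add: node_eq_iff[OF assms(1)]) blast
  then show ?thesis using periodic by blast
qed

lemma card_occupied_lantern_verts:
  assumes "0 < t"
  shows "card (occupied (2 * int t) (lantern_verts (2 * int t)) i) =
    (if i \<in> {0, 6} then 1 else if i \<in> {1, 5} then t else if i \<le> 6 then 2 * t else 0)"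
proof -
  let ?m = "2 * int t"
  have col: "occupied ?m (lantern_verts ?m) i = {a \<in> {0..<?m}. site ?m i a}"
    using assms by (simp add: occupied_def node_in_lantern_verts_iff)
  consider "i \<in> {0, 6}" | "i \<in> {1, 5}" | "i \<notin> {0, 6, 1, 5}" "i \<le> 6" | "6 < i" by fastforce
  then show ?thesis
  proof cases
    case 1
    have "{a \<in> {0..<?m}. site ?m i a} = {0}"
    proof -
      have "a = 0" if "?m dvd a" "0 \<le> a" "a < ?m" for a
        using that zdvd_not_zless[of a ?m] by fastforce
      then show ?thesis using 1 assms by (auto simp: site_def)
    qed
    then show ?thesis using 1 col by simp
  next
    case 2
    have "{a \<in> {0..<?m}. site ?m i a} = (\<lambda>n. 2 * int n) ` {..<t}"
    proof
      show "{a \<in> {0..<?m}. site ?m i a} \<subseteq> (\<lambda>n. 2 * int n) ` {..<t}"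
      proof
        fix a assume "a \<in> {a \<in> {0..<?m}. site ?m i a}"
        then have "a = 2 * int (nat (a div 2))" "nat (a div 2) < t" using 2 by (auto simp: site_def)
        then show "a \<in> (\<lambda>n. 2 * int n) ` {..<t}" by blast
      qed
    qed (use 2 in \<open>auto simp: site_def\<close>)
    then show ?thesis using 2 col by (auto simp: card_image inj_on_def)
  next
    case 3
    then have "{a \<in> {0..<?m}. site ?m i a} = {0..<?m}" by (auto simp: site_def)
    then show ?thesis using 3 col by auto
  next
    case 4
    then show ?thesis unfolding col by (auto simp: site_def)
  qed
qed

lemma card_lantern_rows:
  assumes "0 < m" "finite I"
  shows "card {v \<in> lantern_verts m. fst (prod_decode v) \<in> I} =
    (\<Sum>i\<in>I. card (occupied m (lantern_verts m) i))"
proof -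
  have "{v \<in> lantern_verts m. fst (prod_decode v) \<in> I} =
      (\<Union>i\<in>I. node m i ` occupied m (lantern_verts m) i)"
  proof
    show "{v \<in> lantern_verts m. fst (prod_decode v) \<in> I} \<subseteq>
        (\<Union>i\<in>I. node m i ` occupied m (lantern_verts m) i)"
    proof
      fix v assume v: "v \<in> {v \<in> lantern_verts m. fst (prod_decode v) \<in> I}"
      then obtain i a where ia: "v = node m i a" unfolding lantern_verts_def by blast
      then have "i \<in> I" using v by (simp add: node_def)
      moreover have "a mod m \<in> occupied m (lantern_verts m) i"
        using v ia assms by (simp add: mod_mem_occupied_iff)
      moreover have "v = node m i (a mod m)" using ia by simp
      ultimately show "v \<in> (\<Union>i\<in>I. node m i ` occupied m (lantern_verts m) i)" by blast
    qed
  qed (auto simp: occupied_def node_def)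
  then have "card {v \<in> lantern_verts m. fst (prod_decode v) \<in> I} =
      (\<Sum>i\<in>I. card (node m i ` occupied m (lantern_verts m) i))"
    using assms by (auto intro!: card_UN_disjoint simp: node_eq_iff)
  also have "\<dots> = (\<Sum>i\<in>I. card (occupied m (lantern_verts m) i))"
    using assms(1) by (intro sum.cong refl card_image) (auto simp: inj_on_def node_eq_iff occupied_def)
  finally show ?thesis .
qed

lemma lantern_verts_row_le: "v \<in> lantern_verts m \<Longrightarrow> fst (prod_decode v) \<le> 6"
  by (auto simp: lantern_verts_def node_def site_def)

lemma finite_lantern_verts:
  assumes "0 < m" shows "finite (lantern_verts m)"
proof (rule finite_subset)
  show "lantern_verts m \<subseteq> (\<lambda>(i, a). node m i a) ` ({..6} \<times> {0..<m})"
  proof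
    fix v assume "v \<in> lantern_verts m"
    then obtain i a where "v = node m i (a mod m)" "i \<le> 6" by (auto simp: lantern_verts_def site_def)
    then show "v \<in> (\<lambda>(i, a). node m i a) ` ({..6} \<times> {0..<m})"
      using assms by (intro image_eqI[of _ _ "(i, a mod m)"]) (simp_all add: atMost_def)
  qed
qed simp

lemma card_lantern_verts:
  assumes "0 < t" shows "card (lantern_verts (2 * int t)) = 8 * t + 2"
proof -
  have "lantern_verts (2 * int t) = {v \<in> lantern_verts (2 * int t). fst (prod_decode v) \<in> {..6}}"
    using lantern_verts_row_le by auto
  then have "card (lantern_verts (2 * int t)) =
      (\<Sum>i\<in>{..6}. card (occupied (2 * int t) (lantern_verts (2 * int t)) i))"
    using assms card_lantern_rows[of "2 * int t" "{..6}"] by simp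
  also have "{..6} = {0, 1, 2, 3, 4, 5, 6::nat}" by auto
  finally show ?thesis using assms by (simp add: card_occupied_lantern_verts)
qed

lemma lantern_adj_sym: "lantern_adj m u v \<Longrightarrow> lantern_adj m v u"
  unfolding lantern_adj_def by (metis insert_commute)

lemma lift_adj: "lift m i a b \<Longrightarrow> lantern_adj m (node m i a) (node m (Suc i) b)"
  unfolding lantern_adj_def by blast

lemma lantern_adj_verts:
  assumes "even m" "lantern_adj m u v" shows "u \<in> lantern_verts m" "v \<in> lantern_verts m"
  using assms lift_site[OF assms(1)] unfolding lantern_adj_def lantern_verts_def
  by (fastforce simp: doubleton_eq_iff)+

lemma lantern_adj_parity:
  "lantern_adj m u v \<Longrightarrow> even (fst (prod_decode u)) \<longleftrightarrow> odd (fst (prod_decode v))"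
  unfolding lantern_adj_def by (auto simp: doubleton_eq_iff node_def)

text \<open>This is 5-connectivity of the graph before edges are deleted. Being phrased for bare
  vertex sets, it also applies after a vertex has been moved from one side into
  \<open>Z\<close>.\<close>

lemma lantern_cut:
  fixes t :: nat and C D Z :: "nat set"
  defines "m \<equiv> 2 * int t"
  assumes t: "5 \<le> t" and Z: "Z \<subseteq> lantern_verts m" "card Z \<le> 4"
    and part: "C \<union> D = lantern_verts m - Z" "C \<inter> D = {}"
    and nonadj: "\<And>u v. u \<in> C \<Longrightarrow> v \<in> D \<Longrightarrow> \<not> lantern_adj m u v"
  shows "C = {} \<or> D = {}"
proof -
  have m: "even m" "10 \<le> m" "0 < m" using t by (auto simp: m_def)
  \<comment> \<open>The map \<open>\<rho>\<close> reads the rows from either pole. Together with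
    exchanging the sides this gives the four instances used by
    \<open>expands_middle\<close>.\<close>
  have ev: "expands (\<lambda>i. card (occupied m C (\<rho> i))) (\<lambda>i. card (occupied m D (\<rho> i)))
      (\<lambda>i. card (occupied m Z (\<rho> i)))"
    if \<rho>: "\<rho> = (\<lambda>i. i) \<or> \<rho> = (\<lambda>i. 6 - i)" and part: "C \<union> D = lantern_verts m - Z" "C \<inter> D = {}"
      and nonadj: "\<And>u v. u \<in> C \<Longrightarrow> v \<in> D \<Longrightarrow> \<not> lantern_adj m u v" for \<rho> C D
  proof -
    have nb: "lantern_adj m (node m (\<rho> i) a) (node m (\<rho> (Suc i)) b)" if "i \<le> 2" "lift m i a b" for i a b
      using \<rho>
    proof
      assume r: "\<rho> = (\<lambda>i. 6 - i)"
      have "lift m (5 - i) b a" using that lift_mirror[of i] by simp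
      then have "lantern_adj m (node m (5 - i) b) (node m (Suc (5 - i)) a)" by (rule lift_adj)
      moreover have "Suc (5 - i) = 6 - i" using that by simp
      ultimately show ?thesis unfolding r using lantern_adj_sym by simp
    qed (use that lift_adj in simp)
    have clos: "v \<in> C \<union> Z" if "u \<in> C" "lantern_adj m u v" for u v
      using that nonadj part lantern_adj_verts[OF m(1)] by blast
    have site: "site m i a" if "i \<le> 1" "node m (\<rho> i) a \<in> lantern_verts m" for i a
      using that \<rho> m by (auto simp: node_in_lantern_verts_iff site_def)
    have "expands (card \<circ> (\<lambda>i. occupied m C (\<rho> i))) (card \<circ> (\<lambda>i. occupied m D (\<rho> i)))
        (card \<circ> (\<lambda>i. occupied m Z (\<rho> i)))"
    proof (rule expands_occupied[OF m(1,2)])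
      fix i a b
      show "occupied m C (\<rho> i) \<subseteq> {0..<m}" "occupied m D (\<rho> i) \<subseteq> {0..<m}"
          "occupied m Z (\<rho> i) \<subseteq> {0..<m}" by (auto simp: occupied_def)
      show "occupied m C (\<rho> i) \<inter> occupied m D (\<rho> i) = {}" "occupied m Z (\<rho> i) \<inter> occupied m D (\<rho> i) = {}"
        using part by (auto simp: occupied_def)
      show "site m i a" if "i \<le> 1" "a \<in> occupied m C (\<rho> i)"
        using that site part by (auto simp: occupied_def)
      show "site m i a" if "i \<le> 1" "a \<in> occupied m D (\<rho> i)"
        using that site part by (auto simp: occupied_def)
      show "b mod m \<in> occupied m C (\<rho> (Suc i)) \<union> occupied m Z (\<rho> (Suc i))"
        if "i \<le> 2" "a \<in> occupied m C (\<rho> i)" "lift m i a b"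
        using clos[OF _ nb[OF that(1,3)]] that(2) m by (simp add: mod_mem_occupied_iff) (simp add: occupied_def)
      show "a mod m \<in> occupied m C (\<rho> i) \<union> occupied m Z (\<rho> i)"
        if "i \<le> 2" "b \<in> occupied m C (\<rho> (Suc i))" "lift m i a b"
        using clos[OF _ lantern_adj_sym[OF nb[OF that(1,3)]]] that(2) m
        by (simp add: mod_mem_occupied_iff) (simp add: occupied_def)
    qed
    then show ?thesis by (simp add: o_def)
  qed
  define c d z where cdz: "c = (\<lambda>i. card (occupied m C i))" "d = (\<lambda>i. card (occupied m D i))"
    "z = (\<lambda>i. card (occupied m Z i))"
  have nonadj': "\<not> lantern_adj m v u" if "u \<in> C" "v \<in> D" for u v
    using nonadj that lantern_adj_sym by blast
  have part': "D \<union> C = lantern_verts m - Z" "D \<inter> C = {}" using part by auto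
  have ex: "expands c d z" "expands d c z"
      "expands (\<lambda>i. c (6 - i)) (\<lambda>i. d (6 - i)) (\<lambda>i. z (6 - i))"
      "expands (\<lambda>i. d (6 - i)) (\<lambda>i. c (6 - i)) (\<lambda>i. z (6 - i))"
    using ev[OF _ part nonadj, of "\<lambda>i. i"] ev[OF _ part' nonadj', of "\<lambda>i. i"]
      ev[OF _ part nonadj, of "\<lambda>i. 6 - i"] ev[OF _ part' nonadj', of "\<lambda>i. 6 - i"]
    by (simp_all add: cdz)
  have tot: "c i + d i + z i = card (occupied m (lantern_verts m) i)" for i
  proof -
    have "occupied m (lantern_verts m) i = (occupied m C i \<union> occupied m D i) \<union> occupied m Z i"
      using part Z by (auto simp: occupied_def)
    moreover have "occupied m C i \<inter> occupied m D i = {}"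
        "(occupied m C i \<union> occupied m D i) \<inter> occupied m Z i = {}"
      using part by (auto simp: occupied_def)
    ultimately show ?thesis by (simp add: cdz card_Un_disjoint)
  qed
  have w: "c 0 + d 0 + z 0 = 1" "c 1 + d 1 + z 1 = t" "c 2 + d 2 + z 2 = 2 * t"
      "c 3 + d 3 + z 3 = 2 * t" "c 4 + d 4 + z 4 = 2 * t" "c 5 + d 5 + z 5 = t" "c 6 + d 6 + z 6 = 1"
    unfolding tot m_def using t by (simp_all add: card_occupied_lantern_verts)
  have "finite Z" using Z(1) finite_lantern_verts[OF m(3)] finite_subset by blast
  then have "(\<Sum>i\<le>6. z i) \<le> 4" using sum_card_occupied_le[OF m(3), of Z 6] Z(2) by (simp add: cdz)
  then have zs: "z 0 + z 1 + z 2 + z 3 + z 4 + z 5 + z 6 \<le> 4"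
    by (simp add: eval_nat_numeral)
  have vanish: "E = {}" if e: "\<And>i. e i = card (occupied m E i)" "E \<subseteq> lantern_verts m"
      "e 0 = 0 \<and> e 1 = 0 \<and> e 2 = 0" "e 3 = 0" "e 6 = 0 \<and> e 5 = 0 \<and> e 4 = 0" for E e
  proof (rule ccontr)
    assume "E \<noteq> {}"
    then obtain i a where ia: "node m i a \<in> E" "i \<le> 6" using e(2)
      by (fastforce simp: lantern_verts_def site_def)
    then have "occupied m E i \<noteq> {}" using mod_mem_occupied_iff[OF m(3)] by blast
    then have "e i \<noteq> 0" using e(1) by simp
    moreover have "i = 0 \<or> i = 1 \<or> i = 2 \<or> i = 3 \<or> i = 4 \<or> i = 5 \<or> i = 6" using ia by linarith
    ultimately show False using e(3-5) by auto
  qed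
  have cC: "C = {}" if "c 3 = 0"
  proof (rule vanish[of c])
    show "c 0 = 0 \<and> c 1 = 0 \<and> c 2 = 0"
      by (rule expands_cap[OF ex(2,1) t]) (use w zs that in linarith)+
    have "c (6 - 0) = 0 \<and> c (6 - 1) = 0 \<and> c (6 - 2) = 0"
      by (rule expands_cap[OF ex(4,3) t]) (use w zs that in simp_all)
    then show "c 6 = 0 \<and> c 5 = 0 \<and> c 4 = 0" by simp
  qed (use that part in \<open>auto simp: cdz\<close>)
  have dD: "D = {}" if "d 3 = 0"
  proof (rule vanish[of d])
    show "d 0 = 0 \<and> d 1 = 0 \<and> d 2 = 0"
      by (rule expands_cap[OF ex(1,2) t]) (use w zs that in linarith)+
    have "d (6 - 0) = 0 \<and> d (6 - 1) = 0 \<and> d (6 - 2) = 0"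
      by (rule expands_cap[OF ex(3,4) t]) (use w zs that in simp_all)
    then show "d 6 = 0 \<and> d 5 = 0 \<and> d 4 = 0" by simp
  qed (use that part in \<open>auto simp: cdz\<close>)
  from expands_middle[OF ex w(1) zs] show ?thesis
    by (elim disjE) (simp_all only: cC dD simp_thms)
qed

section \<open>A drawing on the cylinder\<close>

text \<open>Two straight strands between the same rows cross iff their ends are in reversed order.\<close>

definition reversed :: "int \<Rightarrow> int \<Rightarrow> int \<Rightarrow> int \<Rightarrow> bool" where
  "reversed a b c d \<longleftrightarrow> a < c \<and> d < b \<or> c < a \<and> b < d"

lemma lift_shift:
  assumes "even m" shows "lift m i (a + k * m) (b + k * m) \<longleftrightarrow> lift m i a b"
  using assms by (simp add: lift_def)

lemma multiple_gap:
  fixes a c m :: int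
  assumes "m dvd a" "m dvd c" "a < c" shows "a + m \<le> c"
  using zdvd_imp_le[of m "c - a"] assms by simp

text \<open>The combinatorial core of 1-planarity: on the universal cover, an edge and the layer it
  lies in determine its crossing partner, if there is one.\<close>

lemma lift_reversed_unique:
  assumes "lift m i a b" "lift m i c d" "lift m i c' d'" "reversed a b c d" "reversed a b c' d'"
  shows "c = c' \<and> d = d'"
proof -
  consider "i = 0" | "i = 1" | "i = 2 \<or> i = 3" | "i = 4" | "i = 5"
    using assms(1) unfolding lift_def by blast
  then show ?thesis
  proof cases
    \<comment> \<open>Fans at different lifts of the pole occupy disjoint windows of length
      \<open>m\<close>, in the order of these lifts, so no pair is reversed.\<close>
    case 1
    then show ?thesis
      using assms multiple_gap[of m a c] multiple_gap[of m c a] by (auto simp: lift_def reversed_def)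
  next
    case 2
    \<comment> \<open>Only the last edge of one star and the first edge of the next star
      cross.\<close>
    have shape: "c = a + 2 \<and> d = b - 1 \<and> b = a + 2 \<or> c = a - 2 \<and> d = b + 1 \<and> b = a - 1"
      if "lift m i c d" "reversed a b c d" for c d
      using assms(1) that 2 unfolding lift_def reversed_def by simp presburger
    show ?thesis using shape[OF assms(2,4)] shape[OF assms(3,5)] by linarith
  next
    case 3
    \<comment> \<open>Only the two opposite diagonals between neighbouring angles cross.\<close>
    have shape: "c = a + 1 \<and> d = b - 1 \<and> b = a + 1 \<or> c = a - 1 \<and> d = b + 1 \<and> b = a - 1"
      if "lift m i c d" "reversed a b c d" for c d
    proof -
      have "-1 \<le> b - a" "b - a \<le> 1" "-1 \<le> d - c" "d - c \<le> 1"
        using assms(1) that(1) 3 unfolding lift_def by auto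
      then show ?thesis using that(2) unfolding reversed_def by presburger
    qed
    show ?thesis using shape[OF assms(2,4)] shape[OF assms(3,5)] by linarith
  next
    case 4
    have shape: "d = b + 2 \<and> c = a - 1 \<and> a = b + 2 \<or> d = b - 2 \<and> c = a + 1 \<and> a = b - 1"
      if "lift m i c d" "reversed a b c d" for c d
      using assms(1) that 4 unfolding lift_def reversed_def by simp presburger
    show ?thesis using shape[OF assms(2,4)] shape[OF assms(3,5)] by linarith
  next
    case 5
    then show ?thesis
      using assms multiple_gap[of m b d] multiple_gap[of m d b] by (auto simp: lift_def reversed_def)
  qed
qed

text \<open>
  Exponentiation wraps the universal cover around the punctured plane, with rows going to concentric
  circles.
\<close>

definition cyl :: "int \<Rightarrow> real \<Rightarrow> real \<Rightarrow> complex" where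
  "cyl m y x = exp (Complex y (2 * pi * x / m))"

lemma cyl_eq_iff:
  assumes "0 < m"
  shows "cyl m y x = cyl m y' x' \<longleftrightarrow> y = y' \<and> (\<exists>k :: int. x = x' + k * m)"
proof -
  have "2 * pi * x / m = 2 * pi * x' / m + 2 * k * pi \<longleftrightarrow> x = x' + k * m" for k :: int
  proof -
    have "2 * pi * x / m = 2 * pi * x' / m + 2 * k * pi \<longleftrightarrow> 2 * pi * x = 2 * pi * (x' + k * m)"
      using assms by (simp add: field_simps)
    then show ?thesis by simp
  qed
  then show ?thesis unfolding cyl_def exp_eq by (auto simp: complex_eq_iff)
qed

definition place :: "int \<Rightarrow> nat \<Rightarrow> complex" where
  "place m v = cyl m (fst (prod_decode v)) (snd (prod_decode v))"

lemma place_node: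
  assumes "0 < m" shows "place m (node m i a) = cyl m i a"
proof -
  have "real (nat (a mod m)) = of_int (a mod m)" using assms by simp
  also have "\<dots> = of_int a + of_int (- (a div m) * m)"
    by (simp add: minus_mult_div_eq_mod[symmetric])
  finally show ?thesis
    unfolding place_def node_def by (simp only: cyl_eq_iff[OF assms] prod_encode_inverse fst_conv snd_conv)
      blast
qed

definition strand :: "int \<Rightarrow> nat \<Rightarrow> int \<Rightarrow> int \<Rightarrow> real \<Rightarrow> complex" where
  "strand m i a b s = cyl m (i + s) (a + s * (b - a))"

lemma strand_ends:
  assumes "0 < m"
  shows "strand m i a b 0 = place m (node m i a)" "strand m i a b 1 = place m (node m (Suc i) b)"
  using assms by (simp_all add: strand_def place_node add.commute)

lemma arc_strand:
  assumes "0 < m" shows "arc (strand m i a b)"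
  unfolding arc_def path_def
proof
  have "strand m i a b =
      (\<lambda>s :: real. exp (of_real (i + s) + \<i> * of_real (2 * pi * (a + s * (b - a)) / m)))"
    by (simp add: fun_eq_iff strand_def cyl_def Complex_eq)
  then show "continuous_on {0..1} (strand m i a b)"
    by (simp only:) (intro continuous_intros, use assms in auto)
  show "inj_on (strand m i a b) {0..1}"
    using assms by (auto simp: inj_on_def strand_def cyl_eq_iff)
qed

text \<open>Vertices lie at integral heights, and the height \<open>i + s\<close> is integral only
  at the ends.\<close>

lemma strand_meets_place:
  assumes "0 < m" "0 \<le> s" "s \<le> 1" "strand m i a b s = place m (node m j c)"
  shows "s = 0 \<or> s = 1"
proof -
  have "real i + s = real j" using assms by (simp add: strand_def place_node cyl_eq_iff)
  then have "s = of_int (int j - int i)" by simp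
  then show ?thesis using assms(2,3) by (simp only: of_int_0_le_iff of_int_le_1_iff) auto
qed

text \<open>Equal heights force the same layer and \<open>s = s'\<close>; the angles agree up to
  \<open>k\<close> full turns, so translating the second edge by \<open>k * m\<close> makes the
  segments meet on the cover. There the differences at the two ends have a vanishing convex
  combination with positive weights, hence opposite signs.\<close>

lemma strand_crossing:
  assumes m: "0 < m" "even m"
    and lifts: "lift m i a b" "lift m j c d"
    and s: "0 < s" "s < 1" "0 < s'" "s' < 1"
    and meet: "strand m i a b s = strand m j c d s'"
    and ne: "{node m i a, node m (Suc i) b} \<noteq> {node m j c, node m (Suc j) d}"
  obtains c' d' where "lift m i c' d'" "reversed a b c' d'"
    "{node m j c, node m (Suc j) d} = {node m i c', node m (Suc i) d'}"
    "(1 - s) * (c' - a) + s * (d' - b) = 0"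
proof -
  obtain k :: int where k: "real i + s = real j + s'" "a + s * (b - a) = c + s' * (d - c) + k * m"
    using meet m by (auto simp: strand_def cyl_eq_iff)
  have "\<bar>real_of_int (int i - int j)\<bar> < 1" using k(1) s by simp
  then have ij: "i = j" by (simp only: of_int_abs[symmetric] of_int_less_1_iff)
  then have ss: "s = s'" using k(1) by simp
  define c' d' where "c' = c + k * m" and "d' = d + k * m"
  have l: "lift m i c' d'" unfolding c'_def d'_def using lifts(2) lift_shift[OF m(2)] ij by simp
  have nodes: "node m i c' = node m j c" "node m (Suc i) d' = node m (Suc j) d"
    using m ij by (simp_all add: node_eq_iff c'_def d'_def)
  have lin: "(1 - s) * (c' - a) + s * (d' - b) = 0"
    using k(2) ss by (simp add: c'_def d'_def algebra_simps)
  have "c' \<noteq> a \<or> d' \<noteq> b" using ne nodes by auto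
  then have "reversed a b c' d'"
  proof -
    have "c' = a \<longleftrightarrow> d' = b" using lin s by auto
    moreover have False if "a < c'" "b < d'"
    proof -
      have "0 < (1 - s) * (c' - a)" "0 < s * (d' - b)" using that s by simp_all
      then show False using lin by simp
    qed
    moreover have False if "c' < a" "d' < b"
    proof -
      have "(1 - s) * (c' - a) < 0" "s * (d' - b) < 0" using that s by (simp_all add: mult_pos_neg)
      then show False using lin by simp
    qed
    ultimately show ?thesis
      using \<open>c' \<noteq> a \<or> d' \<noteq> b\<close> unfolding reversed_def by (metis linorder_neqE)
  qed
  then show thesis using that l nodes lin by metis
qed

text \<open>Edges are only required to be among the lifted ones, which covers the graphs with edges
  deleted at a vertex.\<close>

lemma one_planar_lantern:
  fixes G :: "(nat, 'b) pre_digraph"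
  assumes m: "0 < m" "even m"
    and V: "verts G \<subseteq> lantern_verts m"
    and E: "\<And>e. e \<in> edge_set G \<Longrightarrow>
      e \<subseteq> verts G \<and> (\<exists>i a b. lift m i a b \<and> e = {node m i a, node m (Suc i) b})"
  shows "one_planar G"
proof -
  \<comment> \<open>An edge has many lifts, differing by full turns; one is fixed for each edge and
    its strand is drawn.\<close>
  obtain I A B where L: "\<And>e. e \<in> edge_set G \<Longrightarrow> lift m (I e) (A e) (B e)"
    and e_eq: "\<And>e. e \<in> edge_set G \<Longrightarrow> e = {node m (I e) (A e), node m (Suc (I e)) (B e)}"
    using E by metis
  define \<gamma> where "\<gamma> e = strand m (I e) (A e) (B e)" for e
  have ends: "{\<gamma> e 0, \<gamma> e 1} = place m ` e" if "e \<in> edge_set G" for e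
    using arg_cong[OF e_eq[OF that], of "image (place m)"] strand_ends[OF m(1)] by (simp add: \<gamma>_def)
  have "drawing G (place m) \<gamma>"
    unfolding drawing_def
  proof (intro conjI ballI)
    show "inj_on (place m) (verts G)"
    proof (rule inj_onI)
      fix v w assume vw: "v \<in> verts G" "w \<in> verts G" "place m v = place m w"
      then obtain i a j b where "v = node m i a" "w = node m j b"
        using V unfolding lantern_verts_def by blast
      moreover from this obtain k :: int where "i = j" "real_of_int a = b + k * m"
        using vw m by (auto simp: place_node cyl_eq_iff)
      moreover from this have "a = b + k * m" by (metis of_int_add of_int_eq_iff of_int_mult)
      ultimately show "v = w" using m by (simp add: node_eq_iff)
    qed
  next
    fix e assume e: "e \<in> edge_set G"
    show "arc (\<gamma> e)" unfolding \<gamma>_def using m(1) by (rule arc_strand)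
    show "{pathstart (\<gamma> e), pathfinish (\<gamma> e)} = place m ` e"
      using ends[OF e] by (simp add: pathstart_def pathfinish_def)
    show "path_image (\<gamma> e) \<inter> place m ` verts G = place m ` e"
    proof
      show "path_image (\<gamma> e) \<inter> place m ` verts G \<subseteq> place m ` e"
      proof
        fix x assume "x \<in> path_image (\<gamma> e) \<inter> place m ` verts G"
        then obtain s v where s: "0 \<le> s" "s \<le> 1" "x = \<gamma> e s" "x = place m v" "v \<in> verts G"
          unfolding path_image_def by auto
        moreover obtain j c where "v = node m j c" using s V unfolding lantern_verts_def by blast
        ultimately have "s = 0 \<or> s = 1" using m strand_meets_place unfolding \<gamma>_def by metis
        then show "x \<in> place m ` e" using s(3) ends[OF e] by auto
      qed
      show "place m ` e \<subseteq> path_image (\<gamma> e) \<inter> place m ` verts G"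
        using E[OF e] ends[OF e, symmetric] by (auto simp: path_image_def)
    qed
  qed
  moreover have "finite (crossings G \<gamma> e) \<and> card (crossings G \<gamma> e) \<le> 1" if e: "e \<in> edge_set G" for e
  proof -
    have cross: "\<exists>s c d. 0 < s \<and> s < 1 \<and> x = \<gamma> e s \<and> lift m (I e) c d \<and> reversed (A e) (B e) c d \<and>
        f = {node m (I e) c, node m (Suc (I e)) d} \<and> (1 - s) * (c - A e) + s * (d - B e) = 0"
      if "(f, x) \<in> crossings G \<gamma> e" for f x
    proof -
      have f: "f \<in> edge_set G" "f \<noteq> e" using that by (auto simp: crossings_def)
      have "x \<in> \<gamma> e ` {0<..<1}" "x \<in> \<gamma> f ` {0<..<1}" using that by (auto simp: crossings_def)
      then obtain s s' where s: "0 < s" "s < 1" "0 < s'" "s' < 1" "x = \<gamma> e s" "x = \<gamma> f s'"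
        by (auto simp only: image_iff greaterThanLessThan_iff)
      have meet: "strand m (I e) (A e) (B e) s = strand m (I f) (A f) (B f) s'"
        using s unfolding \<gamma>_def by simp
      have ne: "{node m (I e) (A e), node m (Suc (I e)) (B e)} \<noteq>
          {node m (I f) (A f), node m (Suc (I f)) (B f)}"
        using f e_eq[OF e] e_eq[OF f(1)] by metis
      obtain c d where "lift m (I e) c d" "reversed (A e) (B e) c d"
          "{node m (I f) (A f), node m (Suc (I f)) (B f)} = {node m (I e) c, node m (Suc (I e)) d}"
          "(1 - s) * (c - A e) + s * (d - B e) = 0"
        using strand_crossing[OF m L[OF e] L[OF f(1)] s(1-4) meet ne] by blast
      then show ?thesis using s e_eq[OF f(1)] by metis
    qed
    have "p = q" if p: "p \<in> crossings G \<gamma> e" and q: "q \<in> crossings G \<gamma> e" for p q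
    proof -
      obtain f x g y where pq: "p = (f, x)" "q = (g, y)" by fastforce
      obtain s c d where 1: "x = \<gamma> e s" "lift m (I e) c d" "reversed (A e) (B e) c d"
          "f = {node m (I e) c, node m (Suc (I e)) d}" "(1 - s) * (c - A e) + s * (d - B e) = 0"
        using cross p pq by blast
      obtain s' c' d' where 2: "y = \<gamma> e s'" "lift m (I e) c' d'" "reversed (A e) (B e) c' d'"
          "g = {node m (I e) c', node m (Suc (I e)) d'}" "(1 - s') * (c' - A e) + s' * (d' - B e) = 0"
        using cross q pq by blast
      have cd: "c = c'" "d = d'" using lift_reversed_unique[OF L[OF e] 1(2) 2(2) 1(3) 2(3)] by auto
      \<comment> \<open>Both parameters solve the same linear equation. Its slope is non-zero
        because the end differences have opposite signs, so the crossing point is determined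
        too.\<close>
      have "(s - s') * (real_of_int (c - A e) - (d - B e)) = 0"
        using 1(5) 2(5) cd by (simp add: algebra_simps)
      moreover have "real_of_int (c - A e) - (d - B e) \<noteq> 0"
        using 1(3) unfolding reversed_def by (auto simp only: of_int_diff[symmetric] of_int_eq_0_iff)
      ultimately have "s = s'" by simp
      then show ?thesis using pq 1 2 cd by simp
    qed
    then have "\<exists>p. crossings G \<gamma> e \<subseteq> {p}" by blast
    then obtain p where "crossings G \<gamma> e \<subseteq> {p}" ..
    then show ?thesis using card_mono[of "{p}" "crossings G \<gamma> e"] finite_subset[of _ "{p}"] by auto
  qed
  ultimately show ?thesis unfolding one_planar_def by blast
qed

section \<open>Lanterns of prescribed connectivity\<close>

text \<open>
  The vertex \<open>node m 1 0\<close> has degree \<open>5\<close>; only its edges to \<open>K\<close> are kept, which lowers the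
  connectivity to \<open>card K\<close>.
\<close>

definition lantern :: "int \<Rightarrow> nat set \<Rightarrow> nat pair_pre_digraph" where
  "lantern m K = \<lparr>pverts = lantern_verts m,
     parcs = {(u, v). lantern_adj m u v \<and> (u = node m 1 0 \<longrightarrow> v \<in> K) \<and> (v = node m 1 0 \<longrightarrow> u \<in> K)}\<rparr>"

lemma lantern_sel [simp]:
  "pverts (lantern m K) = lantern_verts m"
  "(u, v) \<in> parcs (lantern m K) \<longleftrightarrow>
     lantern_adj m u v \<and> (u = node m 1 0 \<longrightarrow> v \<in> K) \<and> (v = node m 1 0 \<longrightarrow> u \<in> K)"
  by (simp_all add: lantern_def)

lemma lantern_apex_neighbours:
  assumes "10 \<le> m"
  shows "{v. lantern_adj m (node m 1 0) v} =
    {node m 0 0, node m 2 (-1), node m 2 0, node m 2 1, node m 2 2}"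
proof
  have m: "0 < m" using assms by simp
  show "{v. lantern_adj m (node m 1 0) v} \<subseteq>
      {node m 0 0, node m 2 (-1), node m 2 0, node m 2 1, node m 2 2}"
  proof
    fix v assume "v \<in> {v. lantern_adj m (node m 1 0) v}"
    then obtain i a b where l: "lift m i a b"
      and e: "node m 1 0 = node m i a \<and> v = node m (Suc i) b \<or>
        node m 1 0 = node m (Suc i) b \<and> v = node m i a"
      unfolding lantern_adj_def by (auto simp: doubleton_eq_iff)
    from e show "v \<in> {node m 0 0, node m 2 (-1), node m 2 0, node m 2 1, node m 2 2}"
    proof
      assume "node m 1 0 = node m i a \<and> v = node m (Suc i) b"
      then have ia: "i = 1" "a mod m = 0" "v = node m 2 b"
        using m by (auto simp: node_eq_iff numeral_2_eq_2)
      have "b - a = -1 \<or> b - a = 0 \<or> b - a = 1 \<or> b - a = 2" using l ia by (auto simp: lift_def)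
      moreover have "v = node m 2 (b - a)" using ia m by (simp add: node_eq_iff mod_diff_eq[symmetric])
      ultimately show ?thesis by auto
    next
      assume "node m 1 0 = node m (Suc i) b \<and> v = node m i a"
      then have ia: "i = 0" "v = node m 0 a" using m by (auto simp: node_eq_iff)
      then have "m dvd a" using l by (auto simp: lift_def)
      then have "v = node m 0 0" using ia m by (simp add: node_eq_iff)
      then show ?thesis by simp
    qed
  qed
  have "lift m 1 0 d" if "-1 \<le> d" "d \<le> 2" for d using that by (simp add: lift_def)
  then have "lantern_adj m (node m 1 0) (node m 2 d)" if "-1 \<le> d" "d \<le> 2" for d
    using that lift_adj[of m 1 0 d] by (simp add: numeral_2_eq_2)
  moreover have "lift m 0 0 0" using m by (simp add: lift_def)
  then have "lantern_adj m (node m 1 0) (node m 0 0)"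
    using lift_adj[of m 0 0 0] lantern_adj_sym by simp
  ultimately show "{node m 0 0, node m 2 (-1), node m 2 0, node m 2 1, node m 2 2} \<subseteq>
      {v. lantern_adj m (node m 1 0) v}"
    by simp
qed

lemma card_lantern_apex_neighbours:
  assumes "10 \<le> m"
  shows "card {v. lantern_adj m (node m 1 0) v} = 5"
proof -
  have "(- 1) mod m = m - 1" using assms by (simp add: zmod_minus1)
  then have "distinct [node m 0 0, node m 2 (-1), node m 2 0, node m 2 1, node m 2 2]"
    using assms by (simp add: node_eq_iff)
  from distinct_card[OF this] show ?thesis
    unfolding lantern_apex_neighbours[OF assms] by simp
qed

lemma pair_graph_lantern:
  assumes "even m" "0 < m" shows "pair_graph (lantern m K)"
proof
  have sub: "parcs (lantern m K) \<subseteq> lantern_verts m \<times> lantern_verts m"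
    using lantern_adj_verts[OF assms(1)] by auto
  then show "finite (parcs (lantern m K))"
    using finite_lantern_verts[OF assms(2)] finite_subset by blast
  show "finite (pverts (lantern m K))" using finite_lantern_verts[OF assms(2)] by simp
  show "fst e \<in> pverts (lantern m K)" "snd e \<in> pverts (lantern m K)"
    if "e \<in> parcs (lantern m K)" for e using that sub by auto
  show "fst e \<noteq> snd e" if "e \<in> parcs (lantern m K)" for e
    using that lantern_adj_parity[of m "fst e" "snd e"] by (cases e) auto
  show "symmetric (with_proj (lantern m K))"
    using lantern_adj_sym by (auto simp: symmetric_def sym_def)
qed

lemma lantern_one_planar:
  assumes "even m" "0 < m" shows "one_planar (with_proj (lantern m K))"
proof (rule one_planar_lantern[OF assms(2,1)])
  fix e assume "e \<in> edge_set (with_proj (lantern m K))"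
  then obtain u v where "e = {u, v}" "lantern_adj m u v" by (auto simp: edge_set_def)
  then show "e \<subseteq> verts (with_proj (lantern m K)) \<and>
      (\<exists>i a b. lift m i a b \<and> e = {node m i a, node m (Suc i) b})"
    using lantern_adj_verts[OF assms(1)] unfolding lantern_adj_def by auto
qed simp

lemma lantern_perfect:
  assumes "even m" "0 < m" shows "perfect (with_proj (lantern m K))"
  using lantern_adj_parity
  by (intro bipartite_perfect[OF pair_graph_lantern[OF assms], of _ "{v. even (fst (prod_decode v))}"])
    auto

lemma lantern_not_hamiltonian:
  assumes "0 < t" shows "\<not> hamiltonian (with_proj (lantern (2 * int t) K))"
proof -
  let ?m = "2 * int t"
  \<comment> \<open>The even rows, with \<open>1 + 2t + 2t + 1\<close> vertices against
    \<open>t + 2t + t\<close> in the odd rows; the explicit finite list is what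
    \<open>card_lantern_rows\<close> counts.\<close>
  let ?B = "{v \<in> lantern_verts ?m. fst (prod_decode v) \<in> {0, 2, 4, 6}}"
  have even: "even i \<longleftrightarrow> i \<in> {0, 2, 4, 6}" if "i \<le> 6" for i :: nat
  proof -
    have "i = 0 \<or> i = 1 \<or> i = 2 \<or> i = 3 \<or> i = 4 \<or> i = 5 \<or> i = 6" using that by linarith
    then show ?thesis by auto
  qed
  have B: "v \<in> ?B \<longleftrightarrow> even (fst (prod_decode v))" if "v \<in> lantern_verts ?m" for v
    using that even[OF lantern_verts_row_le[OF that]] by blast
  have cardB: "card ?B = 4 * t + 2"
    using assms card_lantern_rows[of ?m "{0, 2, 4, 6}"] by (simp add: card_occupied_lantern_verts)
  have fin: "finite (lantern_verts ?m)" using assms finite_lantern_verts by simp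
  show ?thesis
  proof (rule bipartite_not_hamiltonian[OF pair_graph_lantern, of _ ?B])
    have "card (lantern_verts ?m - ?B) = 4 * t"
      using card_Diff_subset[of ?B "lantern_verts ?m"] fin cardB card_lantern_verts[OF assms]
        finite_subset[OF _ fin, of ?B] by auto
    then show "card (pverts (lantern ?m K) - ?B) < card ?B" using cardB by simp
    show "v \<notin> ?B" if "(u, v) \<in> parcs (lantern ?m K)" "u \<in> ?B" for u v
    proof -
      have adj: "lantern_adj ?m u v" using that by simp
      then show ?thesis
        using that(2) B[of u] B[of v] lantern_adj_parity[OF adj] lantern_adj_verts[OF _ adj] by simp
    qed
  qed (use assms in auto)
qed

text \<open>Deleting \<open>K\<close> isolates \<open>node m 1 0\<close>. A separator with fewer
  than \<open>k\<close> vertices is turned into a cut of the full graph with at most four vertices,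
  contradicting \<open>lantern_cut\<close>.\<close>

lemma lantern_connectivity:
  fixes t k :: nat
  defines "m \<equiv> 2 * int t"
  assumes t: "5 \<le> t" and K: "K \<subseteq> {v. lantern_adj m (node m 1 0) v}" "card K = k"
  shows "connectivity (with_proj (lantern m K)) = k"
proof -
  let ?x = "node m 1 0"
  have m: "even m" "10 \<le> m" "0 < m" using t by (auto simp: m_def)
  have fin: "finite (lantern_verts m)" using finite_lantern_verts m by simp
  have x: "?x \<in> lantern_verts m" using m by (simp add: node_in_lantern_verts_iff site_def)
  have KV: "K \<subseteq> lantern_verts m" using K lantern_adj_verts[OF m(1)] by blast
  have irrefl: "\<not> lantern_adj m v v" for v using lantern_adj_parity by blast
  have xK: "?x \<notin> K" using K irrefl by blast
  have cardN: "card {v. lantern_adj m ?x v} = 5" using card_lantern_apex_neighbours m by simp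
  then have finN: "finite {v. lantern_adj m ?x v}" by (metis card.infinite zero_neq_numeral)
  then have k5: "k \<le> 5" using K cardN card_mono by metis
  have finK: "finite K" using finN K finite_subset by blast
  show ?thesis
  proof (rule connectivity_eqI)
    have "card (insert ?x K) \<le> 6" using k5 K finK xK by simp
    moreover have "card (lantern_verts m) = 8 * t + 2"
      using t card_lantern_verts[of t] by (simp add: m_def)
    ultimately have "card (insert ?x K) < card (lantern_verts m)" using t by linarith
    then have "lantern_verts m - insert ?x K \<noteq> {}"
      using finK card_mono[of "insert ?x K" "lantern_verts m"] by fastforce
    then show "separation (lantern m K) K {?x} (lantern_verts m - insert ?x K)"
      using x xK KV by (auto simp: separation_def)
  next
    fix Z C D assume Z: "Z \<subseteq> pverts (lantern m K)" "card Z < k"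
    \<comment> \<open>By symmetry of the two sides the special vertex may be assumed to lie outside
      \<open>D\<close>; it is then in \<open>C\<close> or in \<open>Z\<close>.\<close>
    have aux: False if s: "separation (lantern m K) Z C D" and xD: "?x \<notin> D" for C D
    proof -
      have CD: "C \<union> D = lantern_verts m - Z" "C \<inter> D = {}" "C \<noteq> {}" "D \<noteq> {}"
        using s by (auto simp: separation_def)
      have na: "\<not> lantern_adj m u v" if "u \<in> C" "v \<in> D" "u \<noteq> ?x" for u v
        using s that xD unfolding separation_def by auto
      show False
      proof (cases "?x \<in> C")
        case False
        then have "\<not> lantern_adj m u v" if "u \<in> C" "v \<in> D" for u v using na that by blast
        then show False
          using lantern_cut[OF t, of Z C D, folded m_def] Z CD k5 by auto
      next
        case True
        \<comment> \<open>As \<open>Z\<close> is smaller than \<open>K\<close>, a kept neighbour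
          survives. It must lie in \<open>C\<close>, so \<open>C\<close> remains non-empty without
          the special vertex.\<close>
        obtain v where v: "v \<in> K" "v \<notin> Z"
          using Z(2) K(2) card_mono[of Z K] finite_subset[OF _ fin, of Z] Z(1) by fastforce
        have adj: "lantern_adj m ?x v" using v K by blast
        have "v \<in> lantern_verts m" using v KV by blast
        have vC: "v \<in> C"
        proof (rule ccontr)
          assume "v \<notin> C"
          then have "v \<in> D" using CD v \<open>v \<in> lantern_verts m\<close> by blast
          moreover have "(?x, v) \<in> parcs (lantern m K)" using adj v irrefl by auto
          ultimately show False using s True unfolding separation_def by blast
        qed
        show False
        proof (cases "k = 5")
          case True
          then have "K = {v. lantern_adj m ?x v}" using K cardN finN by (metis card_subset_eq)
          then have "\<not> lantern_adj m u v" if "u \<in> C" "v \<in> D" for u v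
            using s that xD unfolding separation_def by fastforce
          then show False using lantern_cut[OF t, of Z C D, folded m_def] Z CD k5 by auto
        next
          case False
          \<comment> \<open>For \<open>k \<le> 4\<close> there is room to delete the special vertex
            as well; all edges missing from the full graph are incident to it.\<close>
          have "card (insert ?x Z) \<le> 4" using False k5 Z card_insert_le_m1[of 4 Z ?x] by simp
          moreover have "insert ?x Z \<subseteq> lantern_verts m" using x Z by simp
          moreover have "(C - {?x}) \<union> D = lantern_verts m - insert ?x Z" "(C - {?x}) \<inter> D = {}"
            using CD xD by auto
          moreover have "\<not> lantern_adj m u v" if "u \<in> C - {?x}" "v \<in> D" for u v using na that by blast
          ultimately have "C - {?x} = {} \<or> D = {}"
            using lantern_cut[OF t, of "insert ?x Z" "C - {?x}" D, folded m_def] by blast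
          then show False using CD vC v(1) xK by blast
        qed
      qed
    qed
    show "\<not> separation (lantern m K) Z C D"
    proof
      assume s: "separation (lantern m K) Z C D"
      then have "?x \<notin> C \<or> ?x \<notin> D" unfolding separation_def by blast
      then show False using aux s separation_commute by blast
    qed
  qed (use fin KV K in auto)
qed

theorem theorem1p2:
  fixes k :: nat
  assumes "1 \<le> k" and "k \<le> 5"
  shows "infinite
    ({G :: nat pair_pre_digraph.
        pair_graph G \<and> \<not> hamiltonian (with_proj G) \<and> one_planar (with_proj G) \<and>
        perfect (with_proj G) \<and> connectivity (with_proj G) = k} // iso_rel)"
proof -
  \<comment> \<open>The shift by 5 meets the bound \<open>5 \<le> t\<close>; the resulting orders
    \<open>8 * (n + 5) + 2\<close> are pairwise different.\<close>
  define m where "m n = 2 * int (n + 5)" for n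
  have m: "even (m n)" "10 \<le> m n" "0 < m n" for n by (simp_all add: m_def)
  have "\<exists>K. K \<subseteq> {v. lantern_adj (m n) (node (m n) 1 0) v} \<and> card K = k" for n
    using assms(2) card_lantern_apex_neighbours[OF m(2)] by (metis obtain_subset_with_card_n)
  then obtain K where K: "\<And>n. K n \<subseteq> {v. lantern_adj (m n) (node (m n) 1 0) v}" "\<And>n. card (K n) = k"
    by metis
  have conn: "connectivity (with_proj (lantern (m n) (K n))) = k" for n
    using lantern_connectivity[of "n + 5"] K unfolding m_def by simp
  have nonham: "\<not> hamiltonian (with_proj (lantern (m n) (K n)))" for n
    unfolding m_def by (rule lantern_not_hamiltonian) simp
  have "inj (\<lambda>n. card (pverts (lantern (m n) (K n))))"
    by (rule injI) (simp add: m_def card_lantern_verts del: of_nat_add)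
  then show ?thesis
    using pair_graph_lantern[OF m(1,3)] lantern_one_planar[OF m(1,3)] lantern_perfect[OF m(1,3)]
      conn nonham
    by (intro infinite_iso_classes[of "\<lambda>n. lantern (m n) (K n)"]) auto
qed

end
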